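(* In the setting described in the context, let $\varepsilon>0$, let the initial approximation $u_0\in\mathcal{X}$ be given, let $i\geqslant1$ and $L_i\in\mathbb{N}$, and suppose $u_{i-1}\neq u$. Then there exist $\mathbf{n}^{(i)}\in\mathbb{N}^{L_i}$ and $C_1>0$ depending only on $\varepsilon$ and the error $u_\infty-u_{\sigma,i-1}$ in the approximation of the high-regularity solution component, as well as $C_2>0$ depending only on $\varepsilon$ and the error $u_\Psi-u_{\Psi,i-1}$ in the approximation of the low-regularity solution component, such that $$|||\varphi_i-\varphi_i^{NN}|||\leqslant\varepsilon,$$ where $\varphi_i=(u-u_{i-1})/|||u-u_{i-1}|||$ and where $\varphi_i^{NN}=\varphi_{\sigma,i}^{NN}+\varphi_{\Psi,i}^{NN}\in V_{\mathbf{n}^{(i)},L_i}^{\sigma,C_1}\oplus V_{\mathcal{M}}^{\Psi,C_2}(\lambda)$ is defined by $$\varphi_i^{NN}=\operatorname*{arg\,max}\left\{\langle r(u_{i-1}),v\rangle \;:\; v\in V_{\mathbf{n}^{(i)},L_i}^{\sigma,C_1}\oplus V_{\mathcal{M}}^{\Psi,C_2}(\lambda),\ |||v|||=1\right\}.$$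
   Context: **Variational problem.** $\mathcal{X}$ is a real Hilbert space of functions on a domain $\Omega\subset\mathbb{R}^d$. $a_{LS}:\mathcal{X}\times\mathcal{X}\to\mathbb{R}$ is a symmetric, continuous, coercive bilinear form, with energy norm $|||v|||=a_{LS}(v,v)^{1/2}$ (equivalent to $\|\cdot\|_{\mathcal{X}}$). $F_{LS}$ is a continuous linear form on $\mathcal{X}$. $u\in\mathcal{X}$ is the unique solution of $a_{LS}(u,v)=F_{LS}(v)$ for all $v\in\mathcal{X}$. For $w\in\mathcal{X}$, the weak residual is $\langle r(w),v\rangle=F_{LS}(v)-a_{LS}(w,v)$. **Neural network sets.** For an activation function $\sigma$ (applied componentwise), $L\in\mathbb{N}$ and $\mathbf{n}=(n_1,\dots,n_L)\in\mathbb{N}^L$, with $n_0=d$ and $x\in\mathbb{R}^{1\times d}$ a row vector, $V_{\mathbf{n},L}^\sigma$ is the set of $v\in\mathcal{X}$ of the form $v(x)=(\sigma\circ\mathbf{T}_L\circ\cdots\circ\sigma\circ\mathbf{T}_1(x))\cdot\mathbf{c}$, where $\mathbf{T}_j(t)=t\cdot\mathbf{W}^{(j)}+\mathbf{b}^{(j)}$, $\mathbf{W}^{(j)}\in\mathbb{R}^{n_{j-1}\times n_j}$, $\mathbf{b}^{(j)}\in\mathbb{R}^{1\times n_j}$, $\mathbf{c}\in\mathbb{R}^{n_L\times1}$. For $C>0$, $V_{\mathbf{n},L}^{\sigma,C}$ is the subset of those $v$ having such a representation with $\|(\mathbf{W},\mathbf{b},\mathbf{c})\|_{\mathcal{NN}}:=\sum_{j=1}^L(\|\mathbf{W}^{(j)}\|_\infty+\|\mathbf{b}^{(j)}\|_\infty)+\|\mathbf{c}\|_\infty\leqslant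 C$. Standing assumptions on $\sigma$: it is such that, for each depth $L$, universal approximation holds, i.e. $\bigcup_{\mathbf{n}\in\mathbb{N}^L}V_{\mathbf{n},L}^\sigma$ is dense in $\mathcal{X}$; and each $V_{\mathbf{n},L}^{\sigma,C}$ is a compact subset of $\mathcal{X}$. **Knowledge-based sets.** $\Psi:\Omega\times\mathbb{R}\to\mathbb{R}$ is a given function, $\mathcal{I}_\Psi=\{\mu\in\mathbb{R}:\Psi(\cdot;\mu)\in\mathcal{X}\}$, $\mathcal{M}\in\mathbb{N}$, and $\lambda=(\lambda_1,\dots,\lambda_{\mathcal{M}})\in\mathcal{I}_\Psi^{\mathcal{M}}$ is fixed. $V_{\mathcal{M}}^\Psi(\lambda)=\{\sum_{j=1}^{\mathcal{M}}d_j\Psi(\cdot;\lambda_j):\mathbf{d}\in\mathbb{R}^{\mathcal{M}}\}$. For $C>0$, $V_{\mathcal{M}}^{\Psi,C}(\lambda)$ is the subset of those functions having such a representation with $\|\mathbf{d}\|_\infty+\|\lambda\|_\infty\leqslant C$. $\oplus$ between sets of functions denotes the set of sums $v_1+v_2$ with $v_1$, $v_2$ in the respective sets. **Solution structure.** $u=u_\infty+u_\Psi$ with $u_\infty\in\mathcal{X}$ (the high-regularity part) and $u_\Psi\in V_{\mathcal{M}}^\Psi(\lambda)$ (the low-regularity part). **Iterates.** The initial approximation is $u_0=u_{\sigma,0}+u_{\Psi,0}$ with $u_{\sigma,0}\in\mathcal{X}$ and $u_{\Psi,0}\in V_{\mathcal{M}}^\Psi(\lambda)$. Given $u_{j-1}\ne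 u$, a basis function $\varphi_j^{NN}=\varphi_{\sigma,j}^{NN}+\varphi_{\Psi,j}^{NN}$ (network part plus knowledge-based part in $V_{\mathcal{M}}^{\Psi}(\lambda)$) is computed as a maximizer of the displayed form (for some choice of widths, depth and parameter bounds at step $j$). Then $u_j$ is the Galerkin approximation: $u_j\in S_j^\Psi:=\mathrm{span}\{u_{\sigma,0},u_{\Psi,0},\varphi_{\sigma,1}^{NN},\varphi_{\Psi,1}^{NN},\dots,\varphi_{\sigma,j}^{NN},\varphi_{\Psi,j}^{NN}\}$ with $a_{LS}(u_j,v)=F_{LS}(v)$ for all $v\in S_j^\Psi$. It is written as $u_j=u_{\sigma,j}+u_{\Psi,j}$ with $u_{\sigma,j}\in\mathrm{span}\{u_{\sigma,0},\varphi_{\sigma,1}^{NN},\dots,\varphi_{\sigma,j}^{NN}\}$ and $u_{\Psi,j}\in\mathrm{span}\{u_{\Psi,0},\varphi_{\Psi,1}^{NN},\dots,\varphi_{\Psi,j}^{NN}\}$. In the phrase "depending only on", the fixed data $\mathcal{X}$, $a_{LS}$, $\sigma$, $L_i$, $\Psi$, $\mathcal{M}$, $\lambda$ are regarded as given. *)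

theory Defs
  imports
    "HOL-Analysis.Analysis"
    "HOL-Library.Set_Algebras"
    "Jordan_Normal_Form.Matrix"
begin

(* Set_Algebras makes A + B the set of all sums x + y with x \<in> A and y \<in> B. *)

no_notation Matrix.vec_index (infixl "$" 100)

section \<open>Hilbert spaces of functions\<close>

text \<open>
  The Hilbert space is the type \<open>'h\<close>; \<open>repr v f\<close> says that the function \<open>f\<close> represents
  the element \<open>v\<close>. Only the values of \<open>f\<close> on \<open>\<Omega>\<close> matter. This covers both spaces of genuine
  functions on \<open>\<Omega>\<close> (representatives agree everywhere on \<open>\<Omega>\<close>) and spaces of classes of functions
  modulo null sets, such as Sobolev spaces (representatives agree almost everywhere on \<open>\<Omega>\<close>).
\<close>

locale hilbert_function_space =
  fixes \<Omega> :: "(real ^ 'd) set"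
    and repr :: "'h::{real_inner, complete_space} \<Rightarrow> (real ^ 'd \<Rightarrow> real) \<Rightarrow> bool"
  assumes domain: "open \<Omega>" "connected \<Omega>" "\<Omega> \<noteq> {}"
    and repr_exists: "\<exists>f. repr v f"
    and repr_inject: "repr v f \<Longrightarrow> repr w f \<Longrightarrow> v = w"
    and repr_cong: "repr v f \<Longrightarrow> (\<And>x. x \<in> \<Omega> \<Longrightarrow> f x = g x) \<Longrightarrow> repr v g"
    and repr_AE_unique: "repr v f \<Longrightarrow> repr v g \<Longrightarrow> AE x in lebesgue. x \<in> \<Omega> \<longrightarrow> f x = g x"
    and repr_add: "repr v f \<Longrightarrow> repr w g \<Longrightarrow> repr (v + w) (\<lambda>x. f x + g x)"
    and repr_scaleR: "repr v f \<Longrightarrow> repr (r *\<^sub>R v) (\<lambda>x. r * f x)"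

section \<open>Variational problem\<close>

definition continuous_coercive_symmetric :: "('h::real_inner \<Rightarrow> 'h \<Rightarrow> real) \<Rightarrow> bool" where
  "continuous_coercive_symmetric a \<longleftrightarrow>
     bounded_bilinear a \<and> (\<forall>v w. a v w = a w v) \<and> (\<exists>\<alpha>>0. \<forall>v. a v v \<ge> \<alpha> * (norm v)\<^sup>2)"

definition energy_norm :: "('h \<Rightarrow> 'h \<Rightarrow> real) \<Rightarrow> 'h \<Rightarrow> real" where
  "energy_norm a v = sqrt (a v v)"

definition weak_residual :: "('h \<Rightarrow> 'h \<Rightarrow> real) \<Rightarrow> ('h \<Rightarrow> real) \<Rightarrow> 'h \<Rightarrow> 'h \<Rightarrow> real" where
  "weak_residual a F w v = F v - a w v"

section \<open>Neural network sets\<close>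

text \<open>
  Points of \<open>real ^ 'd\<close> become \<open>1 \<times> d\<close> row matrices through a fixed enumeration of the coordinates.
  The choice is immaterial: another one permutes the rows of the first weight matrix, which
  changes neither the sets of network functions nor the parameter norm.
\<close>

definition row_of :: "real ^ 'd \<Rightarrow> real mat" where
  "row_of x = mat 1 CARD('d) (\<lambda>(_, j). x $ from_nat_into (UNIV :: 'd set) j)"

text \<open>A network is given by the list of the pairs \<open>(W, b)\<close> of its layers, first layer first,
  and by the column \<open>c\<close> of output coefficients.\<close>

definition nn_fun ::
  "(real \<Rightarrow> real) \<Rightarrow> (real mat \<times> real mat) list \<Rightarrow> real mat \<Rightarrow> real ^ 'd \<Rightarrow> real" where
  "nn_fun \<sigma> \<theta> c x = (foldl (\<lambda>t (W, b). map_mat \<sigma> (t * W + b)) (row_of x) \<theta> * c) $$ (0, 0)"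

definition nn_params :: "nat \<Rightarrow> nat list \<Rightarrow> (real mat \<times> real mat) list \<Rightarrow> real mat \<Rightarrow> bool" where
  "nn_params d n \<theta> c \<longleftrightarrow>
     length \<theta> = length n \<and>
     (\<forall>j<length n. fst (\<theta> ! j) \<in> carrier_mat ((d # n) ! j) (n ! j) \<and>
                   snd (\<theta> ! j) \<in> carrier_mat 1 (n ! j)) \<and>
     c \<in> carrier_mat (last n) 1"

text \<open>The norm \<open>\<parallel>\<cdot>\<parallel>\<^sub>\<infinity>\<close> of a matrix of parameters is the largest absolute value of its entries.\<close>

definition mat_infnorm :: "real mat \<Rightarrow> real" where
  "mat_infnorm A = Max (abs ` elements_mat A)"

definition nn_norm :: "(real mat \<times> real mat) list \<Rightarrow> real mat \<Rightarrow> real" where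
  "nn_norm \<theta> c = (\<Sum>(W, b)\<leftarrow>\<theta>. mat_infnorm W + mat_infnorm b) + mat_infnorm c"

definition widths :: "nat \<Rightarrow> nat list set" where
  "widths L = {n. length n = L \<and> (\<forall>k\<in>set n. k \<ge> 1)}"

definition nn_set ::
  "('h \<Rightarrow> (real ^ 'd \<Rightarrow> real) \<Rightarrow> bool) \<Rightarrow> (real \<Rightarrow> real) \<Rightarrow> nat list \<Rightarrow> 'h set" where
  "nn_set repr \<sigma> n = {v. \<exists>\<theta> c. nn_params CARD('d) n \<theta> c \<and> repr v (nn_fun \<sigma> \<theta> c)}"

definition nn_set_bounded ::
  "('h \<Rightarrow> (real ^ 'd \<Rightarrow> real) \<Rightarrow> bool) \<Rightarrow> (real \<Rightarrow> real) \<Rightarrow> nat list \<Rightarrow> real \<Rightarrow> 'h set" where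
  "nn_set_bounded repr \<sigma> n C =
     {v. \<exists>\<theta> c. nn_params CARD('d) n \<theta> c \<and> nn_norm \<theta> c \<le> C \<and> repr v (nn_fun \<sigma> \<theta> c)}"

definition universal_approximation ::
  "('h::topological_space \<Rightarrow> (real ^ 'd \<Rightarrow> real) \<Rightarrow> bool) \<Rightarrow> (real \<Rightarrow> real) \<Rightarrow> bool" where
  "universal_approximation repr \<sigma> \<longleftrightarrow>
     (\<forall>L\<ge>1. closure (\<Union>n\<in>widths L. nn_set repr \<sigma> n) = UNIV)"

definition compact_nn_sets ::
  "('h::topological_space \<Rightarrow> (real ^ 'd \<Rightarrow> real) \<Rightarrow> bool) \<Rightarrow> (real \<Rightarrow> real) \<Rightarrow> bool" where
  "compact_nn_sets repr \<sigma> \<longleftrightarrow>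
     (\<forall>L\<ge>1. \<forall>n\<in>widths L. \<forall>C>0. compact (nn_set_bounded repr \<sigma> n C))"

section \<open>Knowledge-based sets\<close>

definition admissible_parameters ::
  "('h \<Rightarrow> (real ^ 'd \<Rightarrow> real) \<Rightarrow> bool) \<Rightarrow> (real ^ 'd \<Rightarrow> real \<Rightarrow> real) \<Rightarrow> real set" where
  "admissible_parameters repr \<Psi> = {\<mu>. \<exists>v. repr v (\<lambda>x. \<Psi> x \<mu>)}"

definition kb_set ::
  "('h \<Rightarrow> (real ^ 'd \<Rightarrow> real) \<Rightarrow> bool) \<Rightarrow> (real ^ 'd \<Rightarrow> real \<Rightarrow> real) \<Rightarrow> real ^ 'm \<Rightarrow> 'h set" where
  "kb_set repr \<Psi> lam = {v. \<exists>d :: real ^ 'm. repr v (\<lambda>x. \<Sum>j\<in>UNIV. d $ j * \<Psi> x (lam $ j))}"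

definition kb_set_bounded ::
  "('h \<Rightarrow> (real ^ 'd \<Rightarrow> real) \<Rightarrow> bool) \<Rightarrow> (real ^ 'd \<Rightarrow> real \<Rightarrow> real) \<Rightarrow> real ^ 'm \<Rightarrow> real \<Rightarrow> 'h set" where
  "kb_set_bounded repr \<Psi> lam C =
     {v. \<exists>d :: real ^ 'm. infnorm d + infnorm lam \<le> C \<and>
           repr v (\<lambda>x. \<Sum>j\<in>UNIV. d $ j * \<Psi> x (lam $ j))}"

section \<open>Iterates\<close>

definition is_nn_maximizer ::
  "('h::real_vector \<Rightarrow> 'h \<Rightarrow> real) \<Rightarrow> ('h \<Rightarrow> real) \<Rightarrow> 'h \<Rightarrow> 'h set \<Rightarrow> 'h \<Rightarrow> bool" where
  "is_nn_maximizer a F w V \<phi> \<longleftrightarrow>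
     is_arg_max (weak_residual a F w) (\<lambda>v. v \<in> V \<and> energy_norm a v = 1) \<phi>"

text \<open>
  \<open>galerkin_nn_iterates \<dots> m u\<sigma> u\<Psi> \<phi>\<sigma> \<phi>\<Psi>\<close>: the sequences describe a run of the method up to
  step \<open>m\<close>; the approximation of step \<open>j\<close> is \<open>u\<sigma> j + u\<Psi> j\<close> and its basis function is
  \<open>\<phi>\<sigma> j + \<phi>\<Psi> j\<close>. Entries beyond step \<open>m\<close> (and \<open>\<phi>\<sigma> 0\<close>, \<open>\<phi>\<Psi> 0\<close>) are irrelevant.
\<close>

definition galerkin_nn_iterates ::
  "('h \<Rightarrow> (real ^ 'd \<Rightarrow> real) \<Rightarrow> bool) \<Rightarrow> ('h \<Rightarrow> 'h \<Rightarrow> real) \<Rightarrow> (real \<Rightarrow> real) \<Rightarrow>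
   (real ^ 'd \<Rightarrow> real \<Rightarrow> real) \<Rightarrow> real ^ 'm \<Rightarrow> ('h \<Rightarrow> real) \<Rightarrow> 'h::real_vector \<Rightarrow> nat \<Rightarrow>
   (nat \<Rightarrow> 'h) \<Rightarrow> (nat \<Rightarrow> 'h) \<Rightarrow> (nat \<Rightarrow> 'h) \<Rightarrow> (nat \<Rightarrow> 'h) \<Rightarrow> bool" where
  "galerkin_nn_iterates repr a \<sigma> \<Psi> lam F u m u\<sigma> u\<Psi> \<phi>\<sigma> \<phi>\<Psi> \<longleftrightarrow>
     u\<Psi> 0 \<in> kb_set repr \<Psi> lam \<and>
     (\<forall>j\<in>{1..m}.
        u\<sigma> (j - 1) + u\<Psi> (j - 1) \<noteq> u \<and>
        (\<exists>L\<ge>1. \<exists>n\<in>widths L. \<exists>C1>0. \<exists>C2>0.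
           \<phi>\<sigma> j \<in> nn_set_bounded repr \<sigma> n C1 \<and>
           \<phi>\<Psi> j \<in> kb_set_bounded repr \<Psi> lam C2 \<and>
           is_nn_maximizer a F (u\<sigma> (j - 1) + u\<Psi> (j - 1))
             (nn_set_bounded repr \<sigma> n C1 + kb_set_bounded repr \<Psi> lam C2) (\<phi>\<sigma> j + \<phi>\<Psi> j)) \<and>
        (let S = span ({u\<sigma> 0, u\<Psi> 0} \<union> \<phi>\<sigma> ` {1..j} \<union> \<phi>\<Psi> ` {1..j}) in
           u\<sigma> j + u\<Psi> j \<in> S \<and> (\<forall>v\<in>S. a (u\<sigma> j + u\<Psi> j) v = F v)) \<and>
        u\<sigma> j \<in> span ({u\<sigma> 0} \<union> \<phi>\<sigma> ` {1..j}) \<and>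
        u\<Psi> j \<in> span ({u\<Psi> 0} \<union> \<phi>\<Psi> ` {1..j}))"

end

theory Submission
  imports Defs
begin

text \<open>
  Let \<open>P\<close> be the \<open>a\<close>-orthogonal projection onto the finite-dimensional space \<open>V\<^sub>\<Psi>\<close>, and let
  \<open>e\<^sub>\<sigma>\<close>, \<open>e\<^sub>\<Psi>\<close> be the errors in the two components, \<open>t\<close> the energy norm of their sum. The
  obvious splitting \<open>e\<^sub>\<sigma>/t + e\<^sub>\<Psi>/t\<close> of the normalized error is useless: both terms blow up when
  \<open>e\<^sub>\<Psi>\<close> is close to \<open>-e\<^sub>\<sigma>\<close>, so no parameter bound that sees only one of them can work. In
  \<open>(e\<^sub>\<sigma> - P e\<^sub>\<sigma>)/t + (P e\<^sub>\<sigma> + e\<^sub>\<Psi>)/t\<close> both terms have energy norm at most 1 by Pythagoras. The second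
  one lies in \<open>V\<^sub>\<Psi>\<close>, whose unit ball has uniformly bounded coefficients. The first one is a multiple
  by some \<open>s \<in> [0, 1]\<close> of the normalization of \<open>e\<^sub>\<sigma> - P e\<^sub>\<sigma>\<close>, so a single network approximates it
  once its output coefficients are scaled by \<open>s\<close>. After normalization this gives a competitor
  of energy norm 1 close to the normalized error \<open>\<phi>\<close>, and on the unit sphere maximizing the
  residual is the same as minimizing the distance to \<open>\<phi>\<close>.
\<close>

section \<open>Energy norms\<close>

locale energy_form =
  fixes a :: "'h::real_inner \<Rightarrow> 'h \<Rightarrow> real"
  assumes form: "continuous_coercive_symmetric a"
begin

sublocale form: bounded_bilinear a
  using form by (simp add: continuous_coercive_symmetric_def)

lemma commute: "a v w = a w v"
  using form by (simp add: continuous_coercive_symmetric_def)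

lemma coercive: "\<exists>\<alpha>>0. \<forall>v. \<alpha> * norm v \<le> energy_norm a v"
proof -
  obtain \<alpha> where \<alpha>: "\<alpha> > 0" "\<And>v. a v v \<ge> \<alpha> * (norm v)\<^sup>2"
    using form by (auto simp: continuous_coercive_symmetric_def)
  have "sqrt \<alpha> * norm v \<le> energy_norm a v" for v
    using real_sqrt_le_mono[OF \<alpha>(2)[of v]] by (simp add: energy_norm_def real_sqrt_mult)
  then show ?thesis
    using \<alpha>(1) by (meson real_sqrt_gt_zero)
qed

lemma nonneg: "a v v \<ge> 0"
proof -
  obtain \<alpha> where \<alpha>: "\<alpha> > 0" "a v v \<ge> \<alpha> * (norm v)\<^sup>2"
    using form by (auto simp: continuous_coercive_symmetric_def)
  then show ?thesis
    by (meson mult_nonneg_nonneg less_imp_le order_trans zero_le_power2)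
qed

lemma energy_norm_nonneg: "energy_norm a v \<ge> 0"
  by (simp add: energy_norm_def nonneg)

lemma energy_norm_power2: "(energy_norm a v)\<^sup>2 = a v v"
  by (simp add: energy_norm_def nonneg)

lemma energy_norm_zero [simp]: "energy_norm a 0 = 0"
  by (simp add: energy_norm_def form.zero_left)

lemma energy_norm_eq_0_iff: "energy_norm a v = 0 \<longleftrightarrow> v = 0"
  using coercive by (metis energy_norm_zero mult_le_0_iff norm_le_zero_iff not_le order_refl)

lemma energy_norm_pos_iff: "energy_norm a v > 0 \<longleftrightarrow> v \<noteq> 0"
  using energy_norm_nonneg[of v] energy_norm_eq_0_iff[of v] by linarith

lemma form_eq_0_iff: "a v v = 0 \<longleftrightarrow> v = 0"
  by (metis energy_norm_eq_0_iff energy_norm_power2 zero_eq_power2)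

lemma energy_norm_scaleR: "energy_norm a (r *\<^sub>R v) = \<bar>r\<bar> * energy_norm a v"
proof -
  have "a (r *\<^sub>R v) (r *\<^sub>R v) = r\<^sup>2 * a v v"
    by (simp add: form.scaleR_left form.scaleR_right power2_eq_square)
  then show ?thesis
    by (simp add: energy_norm_def real_sqrt_mult)
qed

lemma continuous_on_energy_norm: "continuous_on S (energy_norm a)"
  unfolding energy_norm_def by (intro continuous_intros form.continuous_on)

lemma continuous_bound: "\<exists>K>0. \<forall>v. energy_norm a v \<le> K * norm v"
proof -
  obtain K where K: "K > 0" "\<And>v w. norm (a v w) \<le> norm v * norm w * K"
    using form.pos_bounded by blast
  have "energy_norm a v \<le> sqrt K * norm v" for v
  proof -
    have "a v v \<le> norm v * norm v * K"
      using K(2)[of v v] by simp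
    then have "sqrt (a v v) \<le> sqrt ((norm v)\<^sup>2 * K)"
      by (simp add: power2_eq_square)
    then show ?thesis
      by (simp add: energy_norm_def real_sqrt_mult mult.commute)
  qed
  then show ?thesis
    using K(1) by (meson real_sqrt_gt_zero)
qed

lemma Cauchy_Schwarz: "a v w \<le> energy_norm a v * energy_norm a w"
proof (cases "w = 0")
  case False
  \<comment> \<open>This \<open>r\<close> minimizes \<open>a (v - r w) (v - r w)\<close>;
    nonnegativity of the minimum is the inequality.\<close>
  define r where "r = a v w / a w w"
  have pos: "a w w > 0"
    using False nonneg[of w] form_eq_0_iff[of w] by linarith
  have "0 \<le> a (v - r *\<^sub>R w) (v - r *\<^sub>R w)"
    by (rule nonneg)
  also have "\<dots> = a v v - 2 * r * a v w + r * (r * a w w)"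
    by (simp add: form.diff_left form.diff_right form.scaleR_left form.scaleR_right
        commute[of w v] algebra_simps)
  also have "\<dots> = a v v - (a v w)\<^sup>2 / a w w"
    using pos by (simp add: r_def power2_eq_square)
  finally have "(a v w)\<^sup>2 \<le> a v v * a w w"
    using pos by (simp add: field_simps)
  also have "\<dots> = (energy_norm a v * energy_norm a w)\<^sup>2"
    by (simp add: power_mult_distrib energy_norm_power2)
  finally show ?thesis
    by (rule power2_le_imp_le) (simp add: energy_norm_nonneg)
qed (simp add: form.zero_right)

lemma energy_norm_add_le: "energy_norm a (v + w) \<le> energy_norm a v + energy_norm a w"
proof (rule power2_le_imp_le)
  have "(energy_norm a (v + w))\<^sup>2 = a v v + 2 * a v w + a w w"
    by (simp add: energy_norm_power2 form.add_left form.add_right commute[of w v])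
  then show "(energy_norm a (v + w))\<^sup>2 \<le> (energy_norm a v + energy_norm a w)\<^sup>2"
    using Cauchy_Schwarz[of v w] by (simp add: power2_sum energy_norm_power2)
qed (simp add: energy_norm_nonneg)

lemma energy_norm_minus_commute: "energy_norm a (v - w) = energy_norm a (w - v)"
  using energy_norm_scaleR[of "-1" "w - v"] by simp

lemma energy_norm_Pythagoras:
  assumes "a v w = 0"
  shows "(energy_norm a (v + w))\<^sup>2 = (energy_norm a v)\<^sup>2 + (energy_norm a w)\<^sup>2"
  using assms by (simp add: energy_norm_power2 form.add_left form.add_right commute[of w v])

text \<open>Gram-Schmidt: each new generator \<open>x\<close> is replaced by its component
  \<open>y\<close> orthogonal to the span so far, and the projection gains a multiple of
  \<open>y\<close>.\<close>

lemma projection_span: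
  assumes "finite S"
  shows "\<exists>p\<in>span S. \<forall>v\<in>span S. a (e - p) v = 0"
  using assms
proof (induction S arbitrary: e rule: finite_induct)
  case (insert x S)
  obtain px where px: "px \<in> span S" "\<And>v. v \<in> span S \<Longrightarrow> a (x - px) v = 0"
    using insert.IH by blast
  obtain pe where pe: "pe \<in> span S" "\<And>v. v \<in> span S \<Longrightarrow> a (e - pe) v = 0"
    using insert.IH by blast
  define y where "y = x - px"
  \<comment> \<open>If \<open>x\<close> already lies in \<open>span S\<close>, then
    \<open>y = 0\<close> and the quotient is 0 by convention; the identity \<open>ry\<close> holds
    in that case too.\<close>
  define r where "r = a e y / a y y"
  have sub: "span S \<subseteq> span (insert x S)"
    by (simp add: span_mono subset_insertI)
  have y: "y \<in> span (insert x S)"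
    unfolding y_def using px(1) sub by (auto intro: span_diff span_base)
  have ry: "r * a y y = a e y"
    by (cases "y = 0") (simp_all add: r_def form_eq_0_iff form.zero_right)
  have "a (e - (pe + r *\<^sub>R y)) v = 0" if "v \<in> span (insert x S)" for v
  proof -
    obtain k where k: "v - k *\<^sub>R x \<in> span S"
      using \<open>v \<in> span (insert x S)\<close> span_breakdown_eq by blast
    \<comment> \<open>Trading \<open>x\<close> for \<open>y\<close> leaves orthogonality to be
      checked only against \<open>z\<close> in \<open>span S\<close> and against
      \<open>y\<close>.\<close>
    define z where "z = (v - k *\<^sub>R x) + k *\<^sub>R px"
    have z: "z \<in> span S"
      unfolding z_def using k px(1) by (intro span_add span_scale)
    have v: "v = z + k *\<^sub>R y"
      by (simp add: z_def y_def algebra_simps)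
    have "a pe y = 0" "a y z = 0" "a (e - pe) z = 0"
      using px(2)[OF pe(1)] px(2)[OF z] pe(2)[OF z] by (simp_all add: y_def commute)
    then show ?thesis
      using ry by (simp add: v form.add_left form.add_right form.diff_left form.scaleR_left
          form.scaleR_right algebra_simps)
  qed
  moreover have "pe + r *\<^sub>R y \<in> span (insert x S)"
    using pe(1) sub y by (auto intro: span_add span_scale)
  ultimately show ?case
    by blast
qed (simp add: form.zero_right)

text \<open>For unit vectors \<open>x\<close> the squared distance to \<phi> is
  \<open>2 - 2 * a \<phi> x\<close>, and the residual is a positive multiple of
  \<open>a \<phi> x\<close>. So a maximizer is a closest unit vector of \<open>V\<close>.\<close>

lemma maximizer_energy_error_le:
  assumes \<phi>: "energy_norm a \<phi> = 1" and "t > 0"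
    and res: "\<And>v. weak_residual a F w v = t * a \<phi> v"
    and v: "v \<in> V" "energy_norm a v = 1"
    and m: "is_nn_maximizer a F w V m"
  shows "energy_norm a (\<phi> - m) \<le> energy_norm a (\<phi> - v)"
proof (rule power2_le_imp_le)
  have unit: "energy_norm a m = 1" and "\<not> t * a \<phi> m < t * a \<phi> v"
    using m v by (auto simp: is_nn_maximizer_def is_arg_max_def res)
  then have le: "a \<phi> v \<le> a \<phi> m"
    using \<open>t > 0\<close> by simp
  have expand: "(energy_norm a (\<phi> - x))\<^sup>2 = 2 - 2 * a \<phi> x" if "energy_norm a x = 1" for x
  proof -
    have "a x x = 1" "a \<phi> \<phi> = 1"
      using that \<phi> by (metis energy_norm_power2 one_power2)+
    then show ?thesis
      by (simp add: energy_norm_power2 form.diff_left form.diff_right commute[of x \<phi>])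
  qed
  show "(energy_norm a (\<phi> - m))\<^sup>2 \<le> (energy_norm a (\<phi> - v))\<^sup>2"
    using le by (simp add: expand unit v(2))
qed (rule energy_norm_nonneg)

text \<open>Extreme value theorem on the intersection of \<open>V\<close> with the energy unit
  sphere. A unit vector in \<open>V\<close> must be known first, since otherwise this set could be
  empty.\<close>

lemma ex_nn_maximizer:
  assumes "compact V" "v \<in> V" "energy_norm a v = 1" "bounded_linear F"
  shows "\<exists>m. is_nn_maximizer a F w V m"
proof -
  have "closed {x. energy_norm a x = 1}"
    by (intro closed_Collect_eq continuous_on_energy_norm continuous_intros)
  then have "compact (V \<inter> {x. energy_norm a x = 1})"
    using assms(1) by blast
  moreover have "continuous_on (V \<inter> {x. energy_norm a x = 1}) (weak_residual a F w)"
    unfolding weak_residual_def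
    by (intro continuous_intros linear_continuous_on assms(4) form.continuous_on)
  moreover have "V \<inter> {x. energy_norm a x = 1} \<noteq> {}"
    using assms by auto
  ultimately obtain m where "m \<in> V" "energy_norm a m = 1"
    "\<And>x. x \<in> V \<Longrightarrow> energy_norm a x = 1 \<Longrightarrow> weak_residual a F w x \<le> weak_residual a F w m"
    using continuous_attains_sup[of "V \<inter> {x. energy_norm a x = 1}" "weak_residual a F w"]
    by auto
  then have "is_nn_maximizer a F w V m"
    by (auto simp: is_nn_maximizer_def is_arg_max_def not_less)
  then show ?thesis ..
qed

end

section \<open>Compact sums and bounded preimages under linear maps\<close>

lemma compact_set_plus:
  fixes A B :: "'v::real_normed_vector set"
  assumes "compact A" "compact B"
  shows "compact (A + B)"
proof -
  have "A + B = {x + y |x y. x \<in> A \<and> y \<in> B}"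
    by (auto simp: set_plus_def)
  then show ?thesis
    using compact_sums[OF assms] by simp
qed

text \<open>The knowledge-based functions may be linearly dependent, so coefficients are not
  determined by the function and have to be chosen well. On the orthogonal complement
  \<open>M\<close> of the kernel \<open>T\<close> is injective, so \<open>norm (T d)\<close> has a
  positive minimum on the unit sphere of \<open>M\<close>; the component of \<open>d\<close> in
  \<open>M\<close> is the good choice.\<close>

lemma linear_ex_bounded_preimage:
  fixes T :: "'n::euclidean_space \<Rightarrow> 'v::real_normed_vector"
  assumes "linear T"
  shows "\<exists>K>0. \<forall>d. \<exists>d'. T d' = T d \<and> norm d' \<le> K * norm (T d)"
proof -
  interpret linear T by fact
  define N where "N = {d. T d = 0}"
  define M where "M = {d. \<forall>x\<in>N. inner x d = 0}"
  have N: "subspace N"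
    by (auto simp: N_def subspace_def add scale zero)
  have M: "subspace M" "closed M"
    by (auto simp: M_def subspace_def inner_add_right intro!: closed_subspace)
  have cont: "continuous_on S T" for S
    using assms linear_continuous_on linear_conv_bounded_linear by blast
  define S where "S = M \<inter> sphere 0 1"
  have S: "compact S"
    using M(2) by (simp add: S_def closed_Int_compact)
  \<comment> \<open>A kernel element of \<open>M\<close> is orthogonal to itself, hence
    zero.\<close>
  have nz: "T d \<noteq> 0" if "d \<in> S" for d
    using that by (auto simp: S_def M_def N_def)
  have "\<exists>b>0. \<forall>d\<in>S. b \<le> norm (T d)"
  proof (cases "S = {}")
    case False
    then obtain m where "m \<in> S" "\<And>d. d \<in> S \<Longrightarrow> norm (T m) \<le> norm (T d)"
      using continuous_attains_inf[OF S False, of "\<lambda>d. norm (T d)"] cont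
      by (auto intro: continuous_on_norm)
    then show ?thesis
      using nz by (intro exI[of _ "norm (T m)"]) auto
  qed (auto intro: exI[of _ 1])
  then obtain b where b: "b > 0" "\<And>d. d \<in> S \<Longrightarrow> b \<le> norm (T d)"
    by blast
  have low: "b * norm d \<le> norm (T d)" if "d \<in> M" for d
  proof (cases "d = 0")
    case False
    then have "d /\<^sub>R norm d \<in> S"
      using that M(1) by (simp add: S_def subspace_scale)
    from b(2)[OF this] have "b \<le> norm (T d) / norm d"
      by (simp add: scale divide_inverse mult.commute)
    then show ?thesis
      using False by (simp add: field_simps)
  qed simp
  have "\<exists>d'. T d' = T d \<and> norm d' \<le> inverse b * norm (T d)" for d
  proof -
    obtain y z where yz: "y \<in> span N" "\<And>w. w \<in> span N \<Longrightarrow> inner w z = 0" "d = y + z"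
      using orthogonal_subspace_decomp_exists[of N d]
      by (metis real_inner_class.orthogonal_def inner_commute)
    have "y \<in> N"
      using yz(1) span_eq_iff[THEN iffD2, OF N] by simp
    then have "T y = 0"
      by (simp add: N_def)
    then have "T z = T d"
      by (simp add: yz(3) add)
    moreover have "z \<in> M"
      using yz(2) by (auto simp: M_def span_base)
    ultimately show ?thesis
      using low[of z] b(1) by (intro exI[of _ z]) (simp add: field_simps)
  qed
  then show ?thesis
    using b(1) by (meson positive_imp_inverse_positive)
qed

section \<open>Network sets\<close>

lemma finite_elements_mat: "finite (elements_mat A)"
  by (simp add: elements_mat_def)

lemma elements_mat_nonempty:
  assumes "A \<in> carrier_mat m n" "0 < m" "0 < n"
  shows "elements_mat A \<noteq> {}"
  using elements_matI[OF assms(1) assms(2) assms(3)] by blast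

text \<open>Positive dimensions keep the set under \<open>Max\<close> nonempty; the
  \<open>Max\<close> of the empty set has no known sign.\<close>

lemma mat_infnorm_nonneg:
  assumes "A \<in> carrier_mat m n" "0 < m" "0 < n"
  shows "mat_infnorm A \<ge> 0"
proof -
  have "A $$ (0, 0) \<in> elements_mat A"
    using elements_matI[OF assms] by blast
  then have "\<bar>A $$ (0, 0)\<bar> \<le> mat_infnorm A"
    unfolding mat_infnorm_def by (intro Max_ge) (simp_all add: finite_elements_mat)
  then show ?thesis
    by linarith
qed

lemma mat_infnorm_smult:
  assumes "A \<in> carrier_mat m n" "0 < m" "0 < n"
  shows "mat_infnorm (s \<cdot>\<^sub>m A) \<le> \<bar>s\<bar> * mat_infnorm A"
proof -
  have A: "s \<cdot>\<^sub>m A \<in> carrier_mat m n"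
    using assms(1) by simp
  have "\<bar>x\<bar> \<le> \<bar>s\<bar> * mat_infnorm A" if x: "x \<in> elements_mat (s \<cdot>\<^sub>m A)" for x
  proof -
    obtain i j where ij: "i < dim_row A" "j < dim_col A" "x = s * A $$ (i, j)"
      using elements_matD[OF x] by auto
    have "A $$ (i, j) \<in> elements_mat A"
      using ij by (intro elements_matI[of A "dim_row A" "dim_col A" i j]) auto
    then have "\<bar>A $$ (i, j)\<bar> \<le> mat_infnorm A"
      unfolding mat_infnorm_def by (intro Max_ge) (simp_all add: finite_elements_mat)
    then show ?thesis
      by (simp add: ij(3) abs_mult mult_left_mono)
  qed
  then show ?thesis
    using elements_mat_nonempty[OF A assms(2,3)]
    unfolding mat_infnorm_def[of "s \<cdot>\<^sub>m A"] by (subst Max_le_iff) (auto simp: finite_elements_mat)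
qed

text \<open>Puts the index \<open>(0, 0)\<close> read by \<open>nn_fun\<close> in range, so that the
  final product can be expanded.\<close>

lemma dim_row_foldl_layers:
  assumes "dim_row t = 1" "\<And>W b. (W, b) \<in> set \<theta> \<Longrightarrow> dim_row b = 1"
  shows "dim_row (foldl (\<lambda>t (W, b). map_mat \<sigma> (t * W + b)) t \<theta>) = 1"
  using assms
proof (induction \<theta> rule: rev_induct)
  case (snoc l \<theta>)
  \<comment> \<open>A matrix sum takes its dimensions from the second summand, here the bias of the
    last layer.\<close>
  have "dim_row (snd l) = 1"
    using snoc.prems(2)[of "fst l" "snd l"] by simp
  then show ?case
    by (simp add: split_beta)
qed simp

lemma nn_params_smult:
  assumes "nn_params d n \<theta> c"
  shows "nn_params d n \<theta> (s \<cdot>\<^sub>m c)"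
  using assms by (simp add: nn_params_def)

text \<open>No activation follows the output coefficients, so for fixed layers the network is linear
  in \<open>c\<close>.\<close>

lemma nn_fun_smult:
  assumes "nn_params d n \<theta> c"
  shows "nn_fun \<sigma> \<theta> (s \<cdot>\<^sub>m c) x = s * nn_fun \<sigma> \<theta> c x"
proof -
  have "dim_row b = 1" if "(W, b) \<in> set \<theta>" for W b
    using that assms by (fastforce simp: nn_params_def in_set_conv_nth)
  then have "dim_row (foldl (\<lambda>t (W, b). map_mat \<sigma> (t * W + b)) (row_of x) \<theta>) = 1"
    by (intro dim_row_foldl_layers) (simp_all add: row_of_def)
  moreover have "dim_col c = 1"
    using assms by (auto simp: nn_params_def)
  ultimately show ?thesis
    by (simp add: nn_fun_def scalar_prod_def sum_distrib_left mult.left_commute)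
qed

text \<open>Scaling \<open>c\<close> leaves the layer terms as they are, even for small
  \<open>s\<close>; hence the factor \<open>M\<close> has to be at least 1.\<close>

lemma nn_norm_smult_le:
  assumes p: "nn_params d n \<theta> c" and n: "n \<in> widths L" "L \<ge> 1" and d: "d \<ge> 1"
    and M: "\<bar>s\<bar> \<le> M" "M \<ge> 1"
  shows "nn_norm \<theta> (s \<cdot>\<^sub>m c) \<le> M * nn_norm \<theta> c"
proof -
  have n_pos: "\<forall>k\<in>set n. k \<ge> 1" and n_len: "length n = L"
    using n by (auto simp: widths_def)
  have pos: "(d # n) ! j > 0" "n ! j > 0" if "j < length n" for j
    using that n_pos d nth_mem[of j "d # n"] nth_mem[of j n] by fastforce+
  have "last n \<in> set n"
    using n(2) n_len by (intro last_in_set) auto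
  then have c: "c \<in> carrier_mat (last n) 1" "0 < last n"
    using p n_pos by (auto simp: nn_params_def)
  have "mat_infnorm W + mat_infnorm b \<ge> 0" if Wb: "(W, b) \<in> set \<theta>" for W b
  proof -
    obtain j where j: "j < length \<theta>" "\<theta> ! j = (W, b)"
      using Wb by (auto simp: in_set_conv_nth)
    then have "j < length n" "W \<in> carrier_mat ((d # n) ! j) (n ! j)" "b \<in> carrier_mat 1 (n ! j)"
      using p by (force simp: nn_params_def)+
    then show ?thesis
      using mat_infnorm_nonneg[of W "(d # n) ! j" "n ! j"] mat_infnorm_nonneg[of b 1 "n ! j"]
        pos[of j] by linarith
  qed
  then have sum: "(\<Sum>(W, b)\<leftarrow>\<theta>. mat_infnorm W + mat_infnorm b) \<ge> 0"
    by (intro sum_list_nonneg) auto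
  have "mat_infnorm (s \<cdot>\<^sub>m c) \<le> M * mat_infnorm c"
    using mat_infnorm_smult[OF c(1,2), of s] mult_right_mono[OF M(1) mat_infnorm_nonneg[OF c(1,2)]]
    by simp
  then show ?thesis
    using mult_right_mono[OF M(2) sum] by (simp add: nn_norm_def distrib_left)
qed

context hilbert_function_space
begin

lemma nn_set_bounded_scaleR:
  assumes n: "n \<in> widths L" "L \<ge> 1" and v: "v \<in> nn_set_bounded repr \<sigma> n C"
    and s: "\<bar>s\<bar> \<le> M" "M \<ge> 1"
  shows "s *\<^sub>R v \<in> nn_set_bounded repr \<sigma> n (M * C)"
proof -
  obtain \<theta> c where c: "nn_params CARD('d) n \<theta> c" "nn_norm \<theta> c \<le> C" "repr v (nn_fun \<sigma> \<theta> c)"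
    using v by (auto simp: nn_set_bounded_def)
  have "repr (s *\<^sub>R v) (nn_fun \<sigma> \<theta> (s \<cdot>\<^sub>m c))"
    using repr_scaleR[OF c(3), of s] by (rule repr_cong) (simp add: nn_fun_smult[OF c(1)])
  moreover have "nn_norm \<theta> (s \<cdot>\<^sub>m c) \<le> M * nn_norm \<theta> c"
    by (rule nn_norm_smult_le[OF c(1) n _ s]) (simp add: Suc_leI)
  then have "nn_norm \<theta> (s \<cdot>\<^sub>m c) \<le> M * C"
    using mult_left_mono[OF c(2), of M] s(2) by linarith
  ultimately show ?thesis
    using nn_params_smult[OF c(1)] unfolding nn_set_bounded_def by blast
qed

text \<open>One choice of widths and bound serves all multiples \<open>s *\<^sub>R v\<close> at
  once. The range up to 2 allows for a factor in \<open>[0, 1]\<close> followed by division by a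
  norm that is at least \<open>1 / 2\<close>.\<close>

lemma ex_nn_set_bounded_approximation:
  assumes "universal_approximation repr \<sigma>" "L \<ge> 1" "\<delta> > 0"
  shows "\<exists>n C v. n \<in> widths L \<and> C > 0 \<and> norm (q - v) \<le> \<delta> \<and>
    (\<forall>s. \<bar>s\<bar> \<le> 2 \<longrightarrow> s *\<^sub>R v \<in> nn_set_bounded repr \<sigma> n C)"
proof -
  have "q \<in> closure (\<Union>n\<in>widths L. nn_set repr \<sigma> n)"
    using assms by (simp add: universal_approximation_def)
  then obtain n v where n: "n \<in> widths L" and v: "v \<in> nn_set repr \<sigma> n" "dist v q < \<delta>"
    using \<open>\<delta> > 0\<close> by (auto simp: closure_approachable)
  then obtain \<theta> c where c: "nn_params CARD('d) n \<theta> c" "repr v (nn_fun \<sigma> \<theta> c)"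
    by (auto simp: nn_set_def)
  define C where "C = max 1 (nn_norm \<theta> c)"
  have "v \<in> nn_set_bounded repr \<sigma> n C"
    unfolding nn_set_bounded_def C_def using c by (auto intro!: exI[of _ \<theta>] exI[of _ c])
  then have "s *\<^sub>R v \<in> nn_set_bounded repr \<sigma> n (2 * C)" if "\<bar>s\<bar> \<le> 2" for s
    using nn_set_bounded_scaleR[OF n assms(2) _ that] by simp
  moreover have "norm (q - v) \<le> \<delta>" "2 * C > 0"
    using v(2) by (auto simp: dist_norm norm_minus_commute C_def)
  ultimately show ?thesis
    using n by blast
qed

section \<open>Knowledge-based sets\<close>

lemma repr_sum:
  assumes "finite J" "\<And>j. j \<in> J \<Longrightarrow> repr (v j) (f j)"
  shows "repr (\<Sum>j\<in>J. v j) (\<lambda>x. \<Sum>j\<in>J. f j x)"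
  using assms
proof (induction J rule: finite_induct)
  case empty
  \<comment> \<open>The zero function is obtained as 0 times an arbitrary representative of
    0.\<close>
  obtain f where "repr 0 f"
    using repr_exists by blast
  then have "repr (0 *\<^sub>R 0) (\<lambda>x. 0 * f x)"
    by (rule repr_scaleR)
  then show ?case
    by simp
next
  case (insert j J)
  then show ?case
    using repr_add[of "v j" "f j" "\<Sum>j\<in>J. v j" "\<lambda>x. \<Sum>j\<in>J. f j x"] by simp
qed

text \<open>Since a function represents at most one element, coefficient vectors act through a
  linear map \<open>T\<close>, and both knowledge-based sets become images under
  \<open>T\<close>.\<close>

lemma ex_kb_linear_map:
  fixes lam :: "real ^ 'm"
  assumes "\<forall>j. lam $ j \<in> admissible_parameters repr \<Psi>"
  shows "\<exists>T :: real ^ 'm \<Rightarrow> 'h. linear T \<and> kb_set repr \<Psi> lam = range T \<and>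
    (\<forall>C. kb_set_bounded repr \<Psi> lam C = T ` {d. infnorm d + infnorm lam \<le> C})"
proof -
  obtain \<psi> where \<psi>: "\<And>j. repr (\<psi> j) (\<lambda>x. \<Psi> x (lam $ j))"
    using assms unfolding admissible_parameters_def mem_Collect_eq by metis
  define T where "T = (\<lambda>d :: real ^ 'm. \<Sum>j\<in>UNIV. d $ j *\<^sub>R \<psi> j)"
  have "linear T"
    by (rule linearI) (simp_all add: T_def scaleR_add_left sum.distrib scaleR_sum_right)
  moreover have "repr (T d) (\<lambda>x. \<Sum>j\<in>UNIV. d $ j * \<Psi> x (lam $ j))" for d
    unfolding T_def by (intro repr_sum repr_scaleR \<psi>) simp
  then have "repr v (\<lambda>x. \<Sum>j\<in>UNIV. d $ j * \<Psi> x (lam $ j)) \<longleftrightarrow> v = T d" for v d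
    using repr_inject by blast
  then have "kb_set repr \<Psi> lam = range T"
    "kb_set_bounded repr \<Psi> lam C = T ` {d. infnorm d + infnorm lam \<le> C}" for C
    by (auto simp: kb_set_def kb_set_bounded_def)
  ultimately show ?thesis
    by blast
qed

end

lemma compact_linear_image_infnorm_le:
  fixes T :: "'n::euclidean_space \<Rightarrow> 'v::real_normed_vector"
  assumes "linear T"
  shows "compact (T ` {d. infnorm d + r \<le> C})"
proof (rule compact_continuous_image)
  show "continuous_on {d. infnorm d + r \<le> C} T"
    using assms linear_continuous_on linear_conv_bounded_linear by blast
  have "closed {d :: 'n. infnorm d + r \<le> C}"
    by (intro closed_Collect_le continuous_intros continuous_on_infnorm)
  moreover have "bounded {d :: 'n. infnorm d + r \<le> C}"
  proof (rule boundedI)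
    fix d :: 'n
    assume "d \<in> {d. infnorm d + r \<le> C}"
    then show "norm d \<le> sqrt DIM('n) * (C - r)"
      by (intro order_trans[OF norm_le_infnorm[of d]] mult_left_mono) auto
  qed
  ultimately show "compact {d :: 'n. infnorm d + r \<le> C}"
    by (simp add: compact_eq_bounded_closed)
qed

text \<open>All generators of the span at step \<open>m\<close> lie in the knowledge-based space.
  This places the low-regularity error there, where it can be added to the projection of the
  high-regularity error.\<close>

lemma galerkin_nn_iterates_kb_part:
  assumes it: "galerkin_nn_iterates repr a \<sigma> \<Psi> lam F u m u\<sigma> u\<Psi> \<phi>\<sigma> \<phi>\<Psi>"
    and sub: "subspace (kb_set repr \<Psi> lam)"
  shows "u\<Psi> m \<in> kb_set repr \<Psi> lam"
proof (cases "m = 0")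
  case False
  have "\<phi>\<Psi> j \<in> kb_set repr \<Psi> lam" if "j \<in> {1..m}" for j
    using it that unfolding galerkin_nn_iterates_def kb_set_def kb_set_bounded_def by blast
  moreover have "u\<Psi> 0 \<in> kb_set repr \<Psi> lam"
    using it by (simp add: galerkin_nn_iterates_def)
  ultimately have "span ({u\<Psi> 0} \<union> \<phi>\<Psi> ` {1..m}) \<subseteq> kb_set repr \<Psi> lam"
    using sub by (intro span_minimal) auto
  moreover have "m \<in> {1..m}"
    using False by simp
  then have "u\<Psi> m \<in> span ({u\<Psi> 0} \<union> \<phi>\<Psi> ` {1..m})"
    using it unfolding galerkin_nn_iterates_def by blast
  ultimately show ?thesis
    by blast
qed (use it in \<open>simp add: galerkin_nn_iterates_def\<close>)

text \<open>Dependence only on the tolerance and one component error is expressed by choosing the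
  functions \<open>N\<close>, \<open>C1\<close>, \<open>C2\<close> before all problem data and
  iterates. Maximizers need not be unique, so existence is asserted and the estimate holds for each
  of them.\<close>

theorem proposition2p5:
  fixes \<Omega> :: "(real ^ 'd) set"
    and repr :: "'h::{real_inner, complete_space} \<Rightarrow> (real ^ 'd \<Rightarrow> real) \<Rightarrow> bool"
    and a :: "'h \<Rightarrow> 'h \<Rightarrow> real"
    and \<sigma> :: "real \<Rightarrow> real"
    and L :: nat
    and \<Psi> :: "real ^ 'd \<Rightarrow> real \<Rightarrow> real"
    and lam :: "real ^ 'm"
  assumes "hilbert_function_space \<Omega> repr"
    and "continuous_coercive_symmetric a"
    and "universal_approximation repr \<sigma>"
    and "compact_nn_sets repr \<sigma>"
    and "\<forall>j. lam $ j \<in> admissible_parameters repr \<Psi>"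
    and "L \<ge> 1"
  shows "\<exists>(N :: real \<Rightarrow> 'h \<Rightarrow> nat list) (C1 :: real \<Rightarrow> 'h \<Rightarrow> real) (C2 :: real \<Rightarrow> 'h \<Rightarrow> real).
    \<forall>(\<epsilon> :: real) (F :: 'h \<Rightarrow> real) (u :: 'h) (u_inf :: 'h) (u_Psi :: 'h) (i :: nat)
     (u\<sigma> :: nat \<Rightarrow> 'h) (u\<Psi> :: nat \<Rightarrow> 'h) (\<phi>\<sigma> :: nat \<Rightarrow> 'h) (\<phi>\<Psi> :: nat \<Rightarrow> 'h).
      \<epsilon> > 0 \<and> bounded_linear F \<and> (\<forall>v. a u v = F v) \<and>
      u = u_inf + u_Psi \<and> u_Psi \<in> kb_set repr \<Psi> lam \<and>
      i \<ge> 1 \<and> galerkin_nn_iterates repr a \<sigma> \<Psi> lam F u (i - 1) u\<sigma> u\<Psi> \<phi>\<sigma> \<phi>\<Psi> \<and>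
      u\<sigma> (i - 1) + u\<Psi> (i - 1) \<noteq> u \<longrightarrow>
      (let u_prev = u\<sigma> (i - 1) + u\<Psi> (i - 1);
           \<phi> = (u - u_prev) /\<^sub>R energy_norm a (u - u_prev);
           n = N \<epsilon> (u_inf - u\<sigma> (i - 1));
           c1 = C1 \<epsilon> (u_inf - u\<sigma> (i - 1));
           c2 = C2 \<epsilon> (u_Psi - u\<Psi> (i - 1));
           V = nn_set_bounded repr \<sigma> n c1 + kb_set_bounded repr \<Psi> lam c2
       in n \<in> widths L \<and> c1 > 0 \<and> c2 > 0 \<and>
          (\<exists>\<phi>NN. is_nn_maximizer a F u_prev V \<phi>NN) \<and>
          (\<forall>\<phi>NN. is_nn_maximizer a F u_prev V \<phi>NN \<longrightarrow> energy_norm a (\<phi> - \<phi>NN) \<le> \<epsilon>))"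
proof -
  interpret hilbert_function_space \<Omega> repr
    by fact
  interpret energy_form a
    by unfold_locales fact
  obtain T :: "real ^ 'm \<Rightarrow> 'h" where T: "linear T" and kb: "kb_set repr \<Psi> lam = range T"
    and kb_bounded: "\<And>C. kb_set_bounded repr \<Psi> lam C = T ` {d. infnorm d + infnorm lam \<le> C}"
    using ex_kb_linear_map[OF assms(5)] by blast
  interpret T: linear T by (fact T)
  have "span (T ` Basis) = range T"
    using linear_span_image[OF T, of Basis] by simp
  then have "\<exists>d. \<forall>d'. a (e - T d) (T d') = 0" for e
    using projection_span[of "T ` Basis" e] by auto
  \<comment> \<open>Here \<open>P e\<close> is a coefficient vector; the projection itself is
    \<open>T (P e)\<close>.\<close>
  then obtain P where P: "\<And>e d. a (e - T (P e)) (T d) = 0"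
    by metis
  define Q where "Q e = e - T (P e)" for e
  \<comment> \<open>If \<open>Q e = 0\<close> then \<open>q e = 0\<close>, which is harmless because
    its factor \<open>s\<close> below vanishes as well.\<close>
  define q where "q e = Q e /\<^sub>R energy_norm a (Q e)" for e
  obtain D where D: "D > 0" "\<And>d. \<exists>d'. T d' = T d \<and> infnorm d' \<le> D * energy_norm a (T d)"
  proof -
    obtain K where K: "K > 0" "\<And>d. \<exists>d'. T d' = T d \<and> norm d' \<le> K * norm (T d)"
      using linear_ex_bounded_preimage[OF T] by blast
    obtain \<alpha> where \<alpha>: "\<alpha> > 0" "\<And>v. \<alpha> * norm v \<le> energy_norm a v"
      using coercive by blast
    have "\<exists>d'. T d' = T d \<and> infnorm d' \<le> K / \<alpha> * energy_norm a (T d)" for d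
    proof -
      obtain d' where d': "T d' = T d" "norm d' \<le> K * norm (T d)"
        using K(2) by blast
      note infnorm_le_norm[of d']
      also note d'(2)
      also have "K * norm (T d) \<le> K / \<alpha> * energy_norm a (T d)"
        using mult_left_mono[OF \<alpha>(2)[of "T d"], of K] K(1) \<alpha>(1) by (simp add: field_simps)
      finally show ?thesis
        using d'(1) by blast
    qed
    then show ?thesis
      using K(1) \<alpha>(1) that[of "K / \<alpha>"] by simp
  qed
  obtain B where B: "B > 0" "\<And>v. energy_norm a v \<le> B * norm v"
    using continuous_bound by blast
  \<comment> \<open>Half of the tolerance goes to the network and half to the later normalization;
    the cap \<open>1 / 2\<close> keeps the competitor away from 0. The implication sits inside the
    existential so that choice yields total functions of the tolerance and \<open>e\<close>.\<close>
  have "\<exists>n C v. \<epsilon> > 0 \<longrightarrow> n \<in> widths L \<and> C > 0 \<and> energy_norm a (q e - v) \<le> min (\<epsilon> / 2) (1 / 2) \<and>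
      (\<forall>s. \<bar>s\<bar> \<le> 2 \<longrightarrow> s *\<^sub>R v \<in> nn_set_bounded repr \<sigma> n C)" for \<epsilon> e
  proof (cases "\<epsilon> > 0")
    case True
    define \<delta> where "\<delta> = min (\<epsilon> / 2) (1 / 2)"
    have "\<delta> / B > 0"
      using True B(1) by (simp add: \<delta>_def)
    then obtain n C v where nCv: "n \<in> widths L" "C > 0" "norm (q e - v) \<le> \<delta> / B"
      "\<forall>s. \<bar>s\<bar> \<le> 2 \<longrightarrow> s *\<^sub>R v \<in> nn_set_bounded repr \<sigma> n C"
      using ex_nn_set_bounded_approximation[OF assms(3) assms(6), of "\<delta> / B" "q e"] by blast
    have "energy_norm a (q e - v) \<le> \<delta>"
      using B(2)[of "q e - v"] nCv(3) B(1) by (simp add: field_simps)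
    then show ?thesis
      using nCv unfolding \<delta>_def by blast
  qed simp
  then obtain N C1 W where approx: "\<And>\<epsilon> e. \<epsilon> > 0 \<Longrightarrow> N \<epsilon> e \<in> widths L \<and> C1 \<epsilon> e > 0 \<and>
      energy_norm a (q e - W \<epsilon> e) \<le> min (\<epsilon> / 2) (1 / 2) \<and>
      (\<forall>s. \<bar>s\<bar> \<le> 2 \<longrightarrow> s *\<^sub>R W \<epsilon> e \<in> nn_set_bounded repr \<sigma> (N \<epsilon> e) (C1 \<epsilon> e))"
    by metis
  \<comment> \<open>The factor 2 leaves room for the final normalization of the competitor.\<close>
  define C2 where "C2 = 2 * D + infnorm lam"
  have C2: "C2 > 0"
    using D(1) infnorm_pos_le[of lam] by (simp add: C2_def)
  have kb_ball: "v \<in> kb_set_bounded repr \<Psi> lam C2" if "v \<in> range T" "energy_norm a v \<le> 2" for v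
  proof -
    obtain d where "T d = v" "infnorm d \<le> D * energy_norm a v"
      using D(2) \<open>v \<in> range T\<close> by blast
    moreover have "D * energy_norm a v \<le> D * 2"
      using D(1) that(2) by simp
    ultimately show ?thesis
      unfolding kb_bounded C2_def by force
  qed

  \<comment> \<open>One step from an arbitrary \<open>w\<close>: \<open>e\<close> is the
    high-regularity error and \<open>T d\<close> the low-regularity one.\<close>
  have step: "N \<epsilon> e \<in> widths L \<and> C1 \<epsilon> e > 0 \<and> (\<exists>m. is_nn_maximizer a F w V m) \<and>
      (\<forall>m. is_nn_maximizer a F w V m \<longrightarrow> energy_norm a ((u - w) /\<^sub>R energy_norm a (u - w) - m) \<le> \<epsilon>)"
    if \<epsilon>: "\<epsilon> > 0" and F: "bounded_linear F" and u: "\<And>v. a u v = F v" and "w \<noteq> u"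
      and uw: "u - w = e + T d"
      and V: "V = nn_set_bounded repr \<sigma> (N \<epsilon> e) (C1 \<epsilon> e) + kb_set_bounded repr \<Psi> lam C2"
    for \<epsilon> F u w e d V
  proof -
    define t where "t = energy_norm a (u - w)"
    define \<phi> where "\<phi> = (u - w) /\<^sub>R t"
    define s where "s = energy_norm a (Q e) / t"
    define p where "p = T (P e + d) /\<^sub>R t"
    define \<delta> where "\<delta> = min (\<epsilon> / 2) (1 / 2)"
    \<comment> \<open>The part \<open>p\<close> is kept exactly, so the only error is
      \<open>s\<close> times that of the network.\<close>
    define w0 where "w0 = s *\<^sub>R W \<epsilon> e + p"
    have t: "t > 0"
      using \<open>w \<noteq> u\<close> by (simp add: t_def energy_norm_pos_iff)
    have split: "u - w = Q e + T (P e + d)"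
      by (simp add: uw Q_def T.add)
    have pyth: "t\<^sup>2 = (energy_norm a (Q e))\<^sup>2 + (energy_norm a (T (P e + d)))\<^sup>2"
      unfolding t_def split by (rule energy_norm_Pythagoras) (simp add: Q_def P)
    have le_t: "energy_norm a (Q e) \<le> t" "energy_norm a (T (P e + d)) \<le> t"
      by (rule power2_le_imp_le; use pyth t in simp)+
    have s: "0 \<le> s" "s \<le> 1"
      using le_t(1) t by (simp_all add: s_def energy_norm_nonneg)
    have p: "energy_norm a p \<le> 1"
      using le_t(2) t by (simp add: p_def energy_norm_scaleR field_simps)
    have unit: "energy_norm a \<phi> = 1"
      using t by (simp add: \<phi>_def energy_norm_scaleR flip: t_def)
    have "s *\<^sub>R q e = Q e /\<^sub>R t"
      by (cases "Q e = 0") (simp_all add: s_def q_def energy_norm_eq_0_iff divide_inverse)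
    then have \<phi>: "\<phi> = s *\<^sub>R q e + p"
      by (simp add: \<phi>_def split p_def scaleR_add_right)
    have W: "energy_norm a (q e - W \<epsilon> e) \<le> \<delta>"
      "\<And>r. \<bar>r\<bar> \<le> 2 \<Longrightarrow> r *\<^sub>R W \<epsilon> e \<in> nn_set_bounded repr \<sigma> (N \<epsilon> e) (C1 \<epsilon> e)"
      using approx[OF \<epsilon>] by (simp_all add: \<delta>_def)
    have "\<phi> - w0 = s *\<^sub>R (q e - W \<epsilon> e)"
      by (simp add: \<phi> w0_def algebra_simps)
    then have "energy_norm a (\<phi> - w0) = s * energy_norm a (q e - W \<epsilon> e)"
      using s(1) by (simp add: energy_norm_scaleR)
    also have "\<dots> \<le> 1 * \<delta>"
      using s W(1) by (intro mult_mono) (auto intro: order_trans[OF energy_norm_nonneg])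
    finally have err: "energy_norm a (\<phi> - w0) \<le> \<delta>"
      by simp
    define b where "b = energy_norm a w0"
    have b: "\<bar>b - 1\<bar> \<le> \<delta>"
      using energy_norm_add_le[of w0 "\<phi> - w0"] energy_norm_add_le[of \<phi> "w0 - \<phi>"] err
        energy_norm_minus_commute[of \<phi> w0] by (simp add: unit b_def)
    have "\<delta> \<le> 1 / 2" "2 * \<delta> \<le> \<epsilon>"
      by (simp_all add: \<delta>_def)
    with b have b_ge: "b \<ge> 1 / 2"
      by linarith
    define v where "v = w0 /\<^sub>R b"
    have v_unit: "energy_norm a v = 1"
      using b_ge by (simp add: v_def energy_norm_scaleR flip: b_def)
    have "w0 = b *\<^sub>R v"
      using b_ge by (simp add: v_def)
    \<comment> \<open>Normalizing moves \<open>w0\<close> by exactly the deviation of its norm from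
      1, which costs a second \<delta>.\<close>
    then have "w0 - v = (b - 1) *\<^sub>R v"
      by (simp add: scaleR_diff_left)
    then have "energy_norm a (w0 - v) \<le> \<delta>"
      using b by (simp add: energy_norm_scaleR v_unit)
    then have v_err: "energy_norm a (\<phi> - v) \<le> \<epsilon>"
      using err energy_norm_add_le[of "\<phi> - w0" "w0 - v"] \<open>2 * \<delta> \<le> \<epsilon>\<close> by simp
    have inv_b: "0 \<le> inverse b" "inverse b \<le> 2"
      using b_ge le_imp_inverse_le[of "1 / 2" b] by simp_all
    have "(inverse b * s) *\<^sub>R W \<epsilon> e \<in> nn_set_bounded repr \<sigma> (N \<epsilon> e) (C1 \<epsilon> e)"
      using s inv_b mult_mono[of "inverse b" 2 s 1] by (intro W(2)) simp
    moreover have "p /\<^sub>R b \<in> kb_set_bounded repr \<Psi> lam C2"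
    proof (rule kb_ball)
      show "p /\<^sub>R b \<in> range T"
        by (simp add: p_def flip: T.scale)
      show "energy_norm a (p /\<^sub>R b) \<le> 2"
        using p inv_b mult_mono[of "inverse b" 2 "energy_norm a p" 1] energy_norm_nonneg[of p]
        by (simp add: energy_norm_scaleR)
    qed
    ultimately have v_mem: "v \<in> V"
      unfolding V v_def w0_def scaleR_add_right scaleR_scaleR by (rule set_plus_intro)
    have "compact (nn_set_bounded repr \<sigma> (N \<epsilon> e) (C1 \<epsilon> e))"
      using assms(4,6) approx[OF \<epsilon>] by (simp add: compact_nn_sets_def)
    then have "compact V"
      unfolding V kb_bounded by (intro compact_set_plus compact_linear_image_infnorm_le T)
    then have "\<exists>m. is_nn_maximizer a F w V m"
      using ex_nn_maximizer v_mem v_unit F by blast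
    \<comment> \<open>As \<open>u\<close> solves the variational problem, the residual at
      \<open>w\<close> is the form applied to the error \<open>u - w\<close>.\<close>
    moreover have "weak_residual a F w x = t * a \<phi> x" for x
      using t by (simp add: weak_residual_def \<phi>_def form.scaleR_left form.diff_left u)
    then have "energy_norm a (\<phi> - m) \<le> \<epsilon>" if "is_nn_maximizer a F w V m" for m
      using maximizer_energy_error_le[OF unit t _ v_mem v_unit that] v_err by force
    ultimately show ?thesis
      using approx[OF \<epsilon>] by (simp add: \<phi>_def t_def)
  qed

  have kb_subspace: "subspace (kb_set repr \<Psi> lam)"
    unfolding kb by (rule linear_subspace_image[OF T subspace_UNIV])
  show ?thesis
  \<comment> \<open>The witness for the low-regularity bound is the constant function with value
    \<open>C2\<close>: one bound serves every tolerance and every error.\<close>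
  proof (intro exI allI impI)
    fix \<epsilon> :: real and F :: "'h \<Rightarrow> real" and u u_inf u_Psi :: 'h and i :: nat
      and u\<sigma> u\<Psi> \<phi>\<sigma> \<phi>\<Psi> :: "nat \<Rightarrow> 'h"
    assume *: "\<epsilon> > 0 \<and> bounded_linear F \<and> (\<forall>v. a u v = F v) \<and>
      u = u_inf + u_Psi \<and> u_Psi \<in> kb_set repr \<Psi> lam \<and>
      i \<ge> 1 \<and> galerkin_nn_iterates repr a \<sigma> \<Psi> lam F u (i - 1) u\<sigma> u\<Psi> \<phi>\<sigma> \<phi>\<Psi> \<and>
      u\<sigma> (i - 1) + u\<Psi> (i - 1) \<noteq> u"
    then have "u\<Psi> (i - 1) \<in> kb_set repr \<Psi> lam"
      using galerkin_nn_iterates_kb_part kb_subspace by blast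
    then have "u_Psi - u\<Psi> (i - 1) \<in> range T"
      using * kb_subspace subspace_diff kb by blast
    then obtain d where d: "u_Psi - u\<Psi> (i - 1) = T d"
      by blast
    have split: "u - (u\<sigma> (i - 1) + u\<Psi> (i - 1)) = (u_inf - u\<sigma> (i - 1)) + T d"
      using * by (simp flip: d)
    have "\<epsilon> > 0" "bounded_linear F" "\<And>v. a u v = F v" "u\<sigma> (i - 1) + u\<Psi> (i - 1) \<noteq> u"
      using * by auto
    note step[OF this split refl]
    then
    show "let u_prev = u\<sigma> (i - 1) + u\<Psi> (i - 1);
           \<phi> = (u - u_prev) /\<^sub>R energy_norm a (u - u_prev);
           n = N \<epsilon> (u_inf - u\<sigma> (i - 1));
           c1 = C1 \<epsilon> (u_inf - u\<sigma> (i - 1));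
           c2 = (\<lambda>_ _. C2) \<epsilon> (u_Psi - u\<Psi> (i - 1));
           V = nn_set_bounded repr \<sigma> n c1 + kb_set_bounded repr \<Psi> lam c2
       in n \<in> widths L \<and> c1 > 0 \<and> c2 > 0 \<and>
          (\<exists>\<phi>NN. is_nn_maximizer a F u_prev V \<phi>NN) \<and>
          (\<forall>\<phi>NN. is_nn_maximizer a F u_prev V \<phi>NN \<longrightarrow> energy_norm a (\<phi> - \<phi>NN) \<le> \<epsilon>)"
      using C2 unfolding Let_def by blast
  qed
qed

end
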